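(* Let $M\ge1$, let $\lambda_1,\dots,\lambda_M\in\mathbb{D}$ be pairwise distinct, and let $H:=\sum_{k=1}^M c_k r_{\lambda_k}$ with $c_1,\dots,c_M\in\mathbb{C}$, where $r_{\lambda}(z):=\frac{1}{1-\overline{\lambda}z}$. Let $\boldsymbol{a}:=(a_0,\dots,a_{M-1}):=(\lambda_1,\dots,\lambda_M)\in\mathbb{D}^M$ and let $\Phi_0^{\boldsymbol a},\dots,\Phi_{M-1}^{\boldsymbol a}$ be the first $M$ Takenaka-Malmquist functions generated by $\boldsymbol{a}$. Then $[c_1,\dots,c_M]^{\mathsf T}\in\mathbb{C}^M$ can be obtained by solving (i.e., is the unique solution of) the upper triangular linear system of equations $$\begin{bmatrix} \overline{\Phi_0^{\boldsymbol a}(\lambda_1)} & \overline{\Phi_0^{\boldsymbol a}(\lambda_2)} & \ldots & \overline{\Phi_0^{\boldsymbol a}(\lambda_M)}\\ 0 & \overline{\Phi_1^{\boldsymbol a}(\lambda_2)} & \ldots & \overline{\Phi_1^{\boldsymbol a}(\lambda_M)}\\ \vdots & \vdots & \ddots & \vdots\\ 0 & 0 & \ldots & \overline{\Phi_{M-1}^{\boldsymbol a}(\lambda_M)} \end{bmatrix} \begin{bmatrix} c_1\\ c_2\\ \vdots\\ c_M\end{bmatrix} = \begin{bmatrix} \langle H,\Phi_0^{\boldsymbol a}\rangle_{H_2(\mathbb{D})}\\ \langle H,\Phi_1^{\boldsymbol a}\rangle_{H_2(\mathbb{D})}\\ \vdots\\ \langle H,\Phi_{M-1}^{\boldsymbol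 a}\rangle_{H_2(\mathbb{D})} \end{bmatrix}.$$
   Context: $\mathbb{D}$ is the open unit disk. $H_2(\mathbb{D})$ is the Hardy space on $\mathbb{D}$ with inner product $\langle f,g\rangle_{H_2(\mathbb{D})}:=\frac{1}{2\pi}\int_{-\pi}^{\pi}f(e^{it})\overline{g(e^{it})}\,dt$ (boundary values on the unit circle). Takenaka-Malmquist functions: for $\boldsymbol a=(a_0,a_1,\dots)$ with $a_n\in\mathbb{D}$, $$\Phi_n^{\boldsymbol a}(z):=\frac{\sqrt{1-|a_n|^2}}{1-\overline{a_n}z}\prod_{j=0}^{n-1}B_{a_j}(z),\qquad B_a(z):=\frac{z-a}{1-\overline{a}z},$$ with the empty product equal to $1$. *)

theory Defs
  imports "HOL-Analysis.Analysis" "Jordan_Normal_Form.Matrix"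
begin

text \<open>Functions on the open unit disk are rendered as total functions on \<open>complex\<close>; the Hardy
  space and its inner product only look at their values on \<open>ball 0 1\<close>.\<close>

definition hardy_space :: "(complex \<Rightarrow> complex) set" where
  "hardy_space = {f. f holomorphic_on ball 0 1 \<and>
     (\<exists>C. \<forall>r\<in>{0..<1::real}.
        1 / (2 * pi) * integral {-pi..pi} (\<lambda>t. (cmod (f (of_real r * cis t)))\<^sup>2) \<le> C)}"

text \<open>The value $f(e^{it})$ on the unit circle of a function on the disk is its radial limit.\<close>

definition boundary_value :: "(complex \<Rightarrow> complex) \<Rightarrow> real \<Rightarrow> complex" where
  "boundary_value f t = Lim (at_left (1::real)) (\<lambda>r. f (of_real r * cis t))"

definition hardy_inner :: "(complex \<Rightarrow> complex) \<Rightarrow> (complex \<Rightarrow> complex) \<Rightarrow> complex" where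
  "hardy_inner f g =
     1 / (2 * of_real pi) *
       integral {-pi..pi} (\<lambda>t. boundary_value f t * cnj (boundary_value g t))"

definition szego_kernel :: "complex \<Rightarrow> complex \<Rightarrow> complex" where
  "szego_kernel w z = 1 / (1 - cnj w * z)"

definition blaschke_factor :: "complex \<Rightarrow> complex \<Rightarrow> complex" where
  "blaschke_factor a z = (z - a) / (1 - cnj a * z)"

definition takenaka_malmquist :: "(nat \<Rightarrow> complex) \<Rightarrow> nat \<Rightarrow> complex \<Rightarrow> complex" where
  "takenaka_malmquist a n z =
     of_real (sqrt (1 - (cmod (a n))\<^sup>2)) / (1 - cnj (a n) * z) * (\<Prod>j<n. blaschke_factor (a j) z)"

lemma one_minus_cnj_mult_nonzero:
  assumes "cmod w < 1" "cmod z \<le> 1"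
  shows "1 - cnj w * z \<noteq> 0"
proof
  assume "1 - cnj w * z = 0"
  then have "cmod w * cmod z = 1"
    by (metis complex_mod_cnj eq_iff_diff_eq_0 norm_mult norm_one)
  moreover have "cmod w * cmod z \<le> cmod w * 1"
    using assms by (intro mult_left_mono) auto
  ultimately show False using assms by simp
qed

text \<open>For functions continuous on the closed disk the radial limit is the value on the circle.\<close>

lemma boundary_value_eq:
  assumes "continuous_on (cball 0 1) f"
  shows "boundary_value f t = f (cis t)"
proof -
  have "continuous_on {0..1} (\<lambda>r::real. f (of_real r * cis t))"
    by (rule continuous_on_compose2[OF assms]) (auto intro!: continuous_intros simp: norm_mult)
  then have "((\<lambda>r::real. f (of_real r * cis t)) \<longlongrightarrow> f (of_real 1 * cis t)) (at 1 within {0..1})"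
    unfolding continuous_on_def by (rule bspec) simp
  then have "((\<lambda>r::real. f (of_real r * cis t)) \<longlongrightarrow> f (cis t)) (at_left 1)"
    by (simp add: at_within_Icc_at_left)
  then show ?thesis
    unfolding boundary_value_def by (intro tendsto_Lim) auto
qed

text \<open>Combinations of kernels and Takenaka--Malmquist functions belong to the Hardy space, so
  \<open>hardy_inner\<close> is the Hardy space inner product on them.\<close>

lemma hardy_spaceI:
  assumes "f holomorphic_on ball 0 1" "continuous_on (cball 0 1) f"
  shows "f \<in> hardy_space"
proof -
  have "bounded (f ` cball 0 1)"
    by (rule compact_imp_bounded, rule compact_continuous_image[OF assms(2) compact_cball])
  then obtain B where B: "\<And>z. z \<in> cball 0 1 \<Longrightarrow> cmod (f z) \<le> B"
    unfolding bounded_iff by (metis imageI)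
  have "integral {-pi..pi} (\<lambda>t. (cmod (f (of_real r * cis t)))\<^sup>2) \<le> integral {-pi..pi} (\<lambda>t. B\<^sup>2)"
    if "r \<in> {0..<1}" for r :: real
  proof (rule integral_le)
    have "continuous_on {-pi..pi} (\<lambda>t. f (of_real r * cis t))"
      using that
      by (intro continuous_on_compose2[OF assms(2)])
         (auto intro!: continuous_intros simp: norm_mult)
    then show "(\<lambda>t. (cmod (f (of_real r * cis t)))\<^sup>2) integrable_on {-pi..pi}"
      by (intro integrable_continuous_real continuous_intros)
    show "(cmod (f (of_real r * cis t)))\<^sup>2 \<le> B\<^sup>2" for t
      using that by (intro power_mono B) (auto simp: norm_mult)
  qed auto
  then have "\<forall>r\<in>{0..<1::real}. 1 / (2 * pi) *
      integral {-pi..pi} (\<lambda>t. (cmod (f (of_real r * cis t)))\<^sup>2)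
      \<le> 1 / (2 * pi) * integral {-pi..pi} (\<lambda>t. B\<^sup>2)"
    by (intro ballI mult_left_mono) simp_all
  then show ?thesis
    using assms(1) unfolding hardy_space_def by blast
qed

lemma szego_combination_in_hardy_space:
  assumes "\<And>k. k \<in> K \<Longrightarrow> w k \<in> ball 0 1"
  shows "(\<lambda>z. \<Sum>k\<in>K. c k * szego_kernel (w k) z) \<in> hardy_space"
proof -
  have nz: "1 - cnj (w k) * z \<noteq> 0" if "k \<in> K" "cmod z \<le> 1" for k z
    using assms[OF that(1)] that(2) by (intro one_minus_cnj_mult_nonzero) auto
  show ?thesis
    unfolding szego_kernel_def
  proof (rule hardy_spaceI)
    show "(\<lambda>z. \<Sum>k\<in>K. c k * (1 / (1 - cnj (w k) * z))) holomorphic_on ball 0 1"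
      by (intro holomorphic_intros nz) auto
    show "continuous_on (cball 0 1) (\<lambda>z. \<Sum>k\<in>K. c k * (1 / (1 - cnj (w k) * z)))"
      by (intro continuous_intros ballI nz) auto
  qed
qed

lemma takenaka_malmquist_in_hardy_space:
  assumes "\<And>j. j \<le> n \<Longrightarrow> a j \<in> ball 0 1"
  shows "takenaka_malmquist a n \<in> hardy_space"
proof -
  have nz: "1 - cnj (a j) * z \<noteq> 0" if "j \<le> n" "cmod z \<le> 1" for j z
    using assms[OF that(1)] that(2) by (intro one_minus_cnj_mult_nonzero) auto
  have eq: "takenaka_malmquist a n = (\<lambda>z. of_real (sqrt (1 - (cmod (a n))\<^sup>2)) / (1 - cnj (a n) * z) *
     (\<Prod>j<n. blaschke_factor (a j) z))"
    by (rule ext) (rule takenaka_malmquist_def)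
  have hol: "blaschke_factor (a j) holomorphic_on ball 0 1"
    and cont: "continuous_on (cball 0 1) (blaschke_factor (a j))" if "j < n" for j
  proof -
    have "blaschke_factor (a j) = (\<lambda>z. (z - a j) / (1 - cnj (a j) * z))"
      by (rule ext) (rule blaschke_factor_def)
    moreover have "(\<lambda>z. (z - a j) / (1 - cnj (a j) * z)) holomorphic_on ball 0 1"
      using that by (intro holomorphic_on_divide holomorphic_intros nz) simp_all
    moreover have "continuous_on (cball 0 1) (\<lambda>z. (z - a j) / (1 - cnj (a j) * z))"
      using that by (intro continuous_on_divide continuous_intros ballI nz) simp_all
    ultimately show "blaschke_factor (a j) holomorphic_on ball 0 1"
      and "continuous_on (cball 0 1) (blaschke_factor (a j))" by simp_all
  qed
  have "(\<lambda>z. of_real (sqrt (1 - (cmod (a n))\<^sup>2)) / (1 - cnj (a n) * z)) holomorphic_on ball 0 1"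
    by (intro holomorphic_on_divide holomorphic_on_const holomorphic_on_diff holomorphic_on_mult
        holomorphic_on_ident nz) simp_all
  moreover have "continuous_on (cball 0 1)
      (\<lambda>z. of_real (sqrt (1 - (cmod (a n))\<^sup>2)) / (1 - cnj (a n) * z) :: complex)"
    by (intro continuous_on_divide continuous_on_const continuous_on_diff continuous_on_mult
        continuous_on_id ballI nz) simp_all
  ultimately show ?thesis
    unfolding eq
    by (intro hardy_spaceI holomorphic_on_mult continuous_on_mult holomorphic_on_prod
        continuous_on_prod hol cont) simp_all
qed

end

theory Submission
  imports Defs "HOL-Complex_Analysis.Cauchy_Integral_Formula" "Jordan_Normal_Form.Determinant"
begin

text \<open>By Cauchy's formula the Szego kernel reproduces point values,
  $\langle r_\lambda, g\rangle = \overline{g(\lambda)}$, so pairing $H$ with $\Phi_i$ gives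
  $\sum_k c_k \overline{\Phi_i(\lambda_k)}$. The Blaschke product in $\Phi_i$ vanishes at
  $\lambda_1, \dots, \lambda_i$, which makes this system upper triangular, and its diagonal has
  no zeros because the $\lambda_k$ are distinct.\<close>

text \<open>On the circle z = \<open>cis t\<close> one has dz = \<open>\<i>\<close> z dt, so
  Cauchy's formula becomes an integral over the angle with kernel z / (z - w).\<close>

lemma integral_cis_Cauchy:
  assumes cont: "continuous_on (cball 0 1) g" and hol: "g holomorphic_on ball 0 1"
    and w: "cmod w < 1"
  shows "((\<lambda>t. g (cis t) * (cis t / (cis t - w))) has_integral 2 * of_real pi * g w) {-pi..pi}"
proof -
  \<comment> \<open>Library circle paths start at angle 0; reflecting the disk moves the parameter interval
    from \<open>{0..2*pi}\<close> to \<open>{-pi..pi}\<close>.\<close>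
  let ?h = "\<lambda>z. g (- z)"
  have "continuous_on (cball 0 1) ?h"
    by (rule continuous_on_compose2[OF cont]) (auto intro!: continuous_intros)
  moreover have "?h holomorphic_on ball 0 1"
    by (rule holomorphic_on_compose_gen[OF _ hol, unfolded o_def]) (auto intro: holomorphic_intros)
  ultimately have
    "((\<lambda>u. ?h u / (u - (- w))) has_contour_integral (2 * of_real pi * \<i> * ?h (- w))) (circlepath 0 1)"
    using w by (intro Cauchy_integral_circlepath) auto
  then have
    "((\<lambda>t. ?h (cis t) / (cis t + w) * \<i> * cis t) has_integral 2 * of_real pi * \<i> * g w)
       (cbox 0 (2 * pi))"
    unfolding circlepath_def by (subst (asm) has_contour_integral_part_circlepath_iff) simp_all
  from has_integral_affinity'[OF this, of 1 pi]
  have "((\<lambda>t. ?h (cis (t + pi)) / (cis (t + pi) + w) * \<i> * cis (t + pi)) has_integral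
      2 * of_real pi * \<i> * g w) {-pi..pi}"
    by simp
  \<comment> \<open>The factor \<open>- \<i>\<close> cancels the \<open>\<i>\<close> from dz, and
    \<open>cis (t + pi) = - cis t\<close> undoes the reflection in \<open>?h\<close>.\<close>
  from has_integral_mult_right[OF this, of "- \<i>"]
  have "((\<lambda>t. - \<i> * (g (cis t) / (w - cis t) * \<i> * (- cis t))) has_integral
      2 * of_real pi * g w) {-pi..pi}"
    by (simp add: cis_mult[symmetric] algebra_simps)
  moreover have "- \<i> * (g (cis t) / (w - cis t) * \<i> * (- cis t)) = g (cis t) * (cis t / (cis t - w))"
    for t
  proof -
    have "w - cis t \<noteq> 0" "cis t - w \<noteq> 0"
      using w norm_cis[of t] by fastforce+
    then show ?thesis
      by (simp add: field_simps)
  qed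
  ultimately show ?thesis
    by simp
qed

lemma continuous_on_szego_kernel:
  assumes "w \<in> ball 0 1"
  shows "continuous_on (cball 0 1) (szego_kernel w)"
proof -
  have "1 - cnj w * z \<noteq> 0" if "cmod z \<le> 1" for z
    using assms that by (intro one_minus_cnj_mult_nonzero) auto
  then have "continuous_on (cball 0 1) (\<lambda>z. 1 / (1 - cnj w * z))"
    by (intro continuous_intros) auto
  then show ?thesis
    by (simp add: szego_kernel_def[abs_def])
qed

text \<open>On the unit circle conjugation is inversion, so the conjugate of the Cauchy kernel is
  the Szego kernel. Conjugating Cauchy's formula for \<open>g\<close> therefore gives the
  reproducing property, and linearity does the rest.\<close>

lemma hardy_inner_szego_sum:
  assumes fin: "finite K" and w: "\<And>k. k \<in> K \<Longrightarrow> w k \<in> ball 0 1"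
    and cont: "continuous_on (cball 0 1) g" and hol: "g holomorphic_on ball 0 1"
  shows "hardy_inner (\<lambda>z. \<Sum>k\<in>K. c k * szego_kernel (w k) z) g = (\<Sum>k\<in>K. c k * cnj (g (w k)))"
proof -
  have kernel: "cnj (cis t / (cis t - v)) = szego_kernel v (cis t)" for t v
  proof -
    have "cnj (cis t / (cis t - v)) = cis t * cis (-t) / (cis t * (cis (-t) - cnj v))"
      by (simp add: cis_cnj)
    also have "\<dots> = szego_kernel v (cis t)"
      by (simp add: szego_kernel_def right_diff_distrib cis_mult mult.commute)
    finally show ?thesis .
  qed
  have "((\<lambda>t. szego_kernel (w k) (cis t) * cnj (g (cis t))) has_integral
      2 * of_real pi * cnj (g (w k))) {-pi..pi}" if "k \<in> K" for k
  proof -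
    have "cmod (w k) < 1"
      using w[OF that] by simp
    from integral_cis_Cauchy[OF cont hol this, THEN has_integral_cnj[THEN iffD2]]
    show ?thesis
      unfolding o_def complex_cnj_mult kernel by (simp add: mult.commute)
  qed
  then have "((\<lambda>t. \<Sum>k\<in>K. c k * (szego_kernel (w k) (cis t) * cnj (g (cis t)))) has_integral
      (\<Sum>k\<in>K. c k * (2 * of_real pi * cnj (g (w k))))) {-pi..pi}"
    by (intro has_integral_sum fin has_integral_mult_right)
  moreover have "boundary_value (\<lambda>z. \<Sum>k\<in>K. c k * szego_kernel (w k) z) t =
      (\<Sum>k\<in>K. c k * szego_kernel (w k) (cis t))" for t
    by (intro boundary_value_eq continuous_intros continuous_on_szego_kernel w)
  ultimately show ?thesis
    unfolding hardy_inner_def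
    by (simp add: boundary_value_eq[OF cont] sum_distrib_right sum_distrib_left sum_divide_distrib
        mult.assoc mult.left_commute integral_unique)
qed

text \<open>Cauchy's formula is applied on the unit circle itself, so continuity up to the boundary
  is required in addition to membership in \<open>hardy_space\<close>.\<close>

lemma takenaka_malmquist_regular:
  assumes a: "\<And>j. j \<le> n \<Longrightarrow> a j \<in> ball 0 1"
  shows "continuous_on (cball 0 1) (takenaka_malmquist a n)"
    and "takenaka_malmquist a n holomorphic_on ball 0 1"
proof -
  have nz: "1 - cnj (a j) * z \<noteq> 0" if "j \<le> n" "cmod z \<le> 1" for j z
    using a[OF that(1)] that(2) by (intro one_minus_cnj_mult_nonzero) auto
  show "continuous_on (cball 0 1) (takenaka_malmquist a n)"
    unfolding takenaka_malmquist_def[abs_def] blaschke_factor_def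
    by (intro continuous_on_mult continuous_on_divide continuous_on_prod continuous_intros ballI nz)
      auto
  show "takenaka_malmquist a n holomorphic_on ball 0 1"
    using takenaka_malmquist_in_hardy_space[OF a] by (simp add: hardy_space_def)
qed

text \<open>The leading quotient has no zero because \<open>a n\<close> lies inside the disk, and
  each Blaschke factor vanishes only at its own node. The product stops before \<open>n\<close>, so
  \<open>a n\<close> is a zero only if it repeats an earlier node.\<close>

lemma takenaka_malmquist_eq_0_iff:
  assumes a: "\<And>j. j \<le> n \<Longrightarrow> a j \<in> ball 0 1" and z: "z \<in> ball 0 1"
  shows "takenaka_malmquist a n z = 0 \<longleftrightarrow> (\<exists>j<n. z = a j)"
proof -
  have nz: "1 - cnj (a j) * z \<noteq> 0" if "j \<le> n" for j
    using a[OF that] z by (intro one_minus_cnj_mult_nonzero) auto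
  have "(cmod (a n))\<^sup>2 < 1"
    using a[of n] by (simp add: abs_square_less_1)
  with nz[of n] have "of_real (sqrt (1 - (cmod (a n))\<^sup>2)) / (1 - cnj (a n) * z) \<noteq> 0"
    by simp
  moreover have "blaschke_factor (a j) z = 0 \<longleftrightarrow> z = a j" if "j < n" for j
    using nz[of j] that by (simp add: blaschke_factor_def)
  ultimately show ?thesis
    by (auto simp: takenaka_malmquist_def)
qed

text \<open>Reduces unique solvability to exhibiting one solution: a nonzero difference of two
  solutions would be a kernel vector of \<open>A\<close>.\<close>

lemma mult_mat_vec_inject:
  fixes A :: "'a :: idom mat"
  assumes A: "A \<in> carrier_mat n n" and det: "det A \<noteq> 0"
    and x: "x \<in> carrier_vec n" and y: "y \<in> carrier_vec n"
  shows "A *\<^sub>v x = A *\<^sub>v y \<longleftrightarrow> x = y"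
proof
  assume "A *\<^sub>v x = A *\<^sub>v y"
  then have "A *\<^sub>v (x - y) = 0\<^sub>v n"
    using A x y by (simp add: mult_minus_distrib_mat_vec)
  then have "x - y = 0\<^sub>v n"
    using det det_0_iff_vec_prod_zero[OF A] x y by (meson minus_carrier_vec)
  then show "x = y"
  proof (intro eq_vecI)
    fix i assume "i < dim_vec y"
    with \<open>x - y = 0\<^sub>v n\<close> x y have "vec_index (x - y) i = 0"
      by simp
    then show "vec_index x i = vec_index y i"
      using \<open>i < dim_vec y\<close> by simp
  qed (use x y in simp)
qed simp

theorem theorem4p3:
  fixes M :: nat
    and lam c a :: "nat \<Rightarrow> complex"
    and H :: "complex \<Rightarrow> complex"
    and A :: "complex mat"
    and b :: "complex vec"
  assumes "M \<ge> 1"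
    and "\<forall>k\<in>{1..M}. lam k \<in> ball 0 1"
    and "inj_on lam {1..M}"
    and "H = (\<lambda>z. \<Sum>k=1..M. c k * szego_kernel (lam k) z)"
    and "\<forall>n<M. a n = lam (n + 1)"
    and "A = mat M M (\<lambda>(i, j).
           if i \<le> j then cnj (takenaka_malmquist a i (lam (j + 1))) else 0)"
    and "b = vec M (\<lambda>i. hardy_inner H (takenaka_malmquist a i))"
  shows "upper_triangular A \<and>
         (\<forall>x\<in>carrier_vec M. A *\<^sub>v x = b \<longleftrightarrow> x = vec M (\<lambda>i. c (i + 1)))"
proof -
  let ?\<Phi> = "takenaka_malmquist a" and ?c = "vec M (\<lambda>i. c (i + 1))"
  have lam: "lam (Suc j) \<in> ball 0 1" if "j < M" for j
    using assms(2) that by auto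
  have a: "a j \<in> ball 0 1" if "j < M" for j
    using assms(5) lam that by simp
  \<comment> \<open>Since \<open>a l\<close> is \<open>lam (Suc l)\<close>, distinctness of the
    nodes turns equality of points into equality of indices. The case \<open>j < i\<close> gives
    triangularity, the case \<open>j = i\<close> the nonzero diagonal.\<close>
  have vanish: "?\<Phi> i (lam (Suc j)) = 0 \<longleftrightarrow> j < i" if "i < M" "j < M" for i j
  proof -
    have "?\<Phi> i (lam (Suc j)) = 0 \<longleftrightarrow> (\<exists>l<i. lam (Suc j) = a l)"
      using a lam that by (intro takenaka_malmquist_eq_0_iff) auto
    also have "\<dots> \<longleftrightarrow> (\<exists>l<i. j = l)"
      using that assms(5) inj_onD[OF assms(3), of "Suc j" "Suc _"] by fastforce
    finally show ?thesis
      by auto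
  qed
  have A: "A \<in> carrier_mat M M"
    by (simp add: assms(6))
  \<comment> \<open>The zeros prescribed below the diagonal agree with the actual values there, so
    each row of \<open>A\<close> yields the full sum over all nodes.\<close>
  have entry: "A $$ (i, j) = cnj (?\<Phi> i (lam (Suc j)))" if "i < M" "j < M" for i j
    using that vanish[of i j] by (auto simp: assms(6))
  have ut: "upper_triangular A"
    using A by (auto simp: entry vanish)
  have "det A \<noteq> 0"
    using upper_triangular_imp_det_eq_0_iff[OF A ut] A by (auto simp: diag_mat_def entry vanish)
  moreover have "A *\<^sub>v ?c = b"
  proof (rule eq_vecI)
    fix i assume "i < dim_vec b"
    then have i: "i < M"
      by (simp add: assms(7))
    have "hardy_inner H (?\<Phi> i) = (\<Sum>k=1..M. c k * cnj (?\<Phi> i (lam k)))"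
      unfolding assms(4) using assms(2) a i
      by (intro hardy_inner_szego_sum takenaka_malmquist_regular) auto
    also have "\<dots> = (\<Sum>j<M. c (Suc j) * cnj (?\<Phi> i (lam (Suc j))))"
      by (simp add: sum.atLeast1_atMost_eq)
    finally show "vec_index (A *\<^sub>v ?c) i = vec_index b i"
      using i A by (simp add: assms(7) scalar_prod_def entry lessThan_atLeast0 mult.commute)
  qed (use A in \<open>simp add: assms(7)\<close>)
  \<comment> \<open>As \<open>?c\<close> solves the system, \<open>A *\<^sub>v x = b\<close> means
    \<open>A *\<^sub>v x = A *\<^sub>v ?c\<close>, and injectivity applies.\<close>
  ultimately show ?thesis
    using ut mult_mat_vec_inject[OF A] by (metis vec_carrier)
qed

end
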